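(* Let $0\le\beta<1$ and write $\boldsymbol{n}=(-\sin\theta,\cos\theta)^T\in\mathbb{S}^1$, $\theta\in[-\pi,\pi]$. For the anisotropic surface energies below, let $k_0$ denote the corresponding minimal stabilizing function. (i) If $\gamma(\boldsymbol{n})=1+\beta\cos2\theta$, then $$k_0(\boldsymbol{n})=4-2\gamma(\boldsymbol{n})+\frac{4\beta^2}{\gamma(\boldsymbol{n})}\qquad\forall\boldsymbol{n}\in\mathbb{S}^1 .$$ (ii) If $\gamma(\boldsymbol{n})=1+\beta\cos4\theta$, then $$k_0(\boldsymbol{n})\le2\gamma(\boldsymbol{n})+\frac{16\beta+16\beta^2}{\gamma(\boldsymbol{n})}\qquad\forall\boldsymbol{n}\in\mathbb{S}^1 .$$
   Context: $\mathbb{S}^1\subset\mathbb{R}^2$ is the unit circle and $^\perp$ denotes clockwise rotation by $\pi/2$, i.e. $(a,b)^\perp=(b,-a)$. A function $\gamma:\mathbb{S}^1\to(0,\infty)$ is extended by $\gamma(\boldsymbol{p})=|\boldsymbol{p}|\gamma(\boldsymbol{p}/|\boldsymbol{p}|)$ for $\boldsymbol{p}\ne\boldsymbol{0}$, $\gamma(\boldsymbol{0})=0$; $\boldsymbol{\xi}(\boldsymbol{n})=\nabla\gamma(\boldsymbol{p})|_{\boldsymbol{p}=\boldsymbol{n}}$. For $\hat{\boldsymbol{n}}\ne\pm\boldsymbol{n}$ in $\mathbb{S}^1$, $$F(\boldsymbol{n},\hat{\boldsymbol{n}})=\frac{\gamma(\hat{\boldsymbol{n}})^2-\gamma(\boldsymbol{n})^2+2\gamma(\boldsymbol{n})(\boldsymbol{\xi}(\boldsymbol{n})\cdot\hat{\boldsymbol{n}}^\perp)(\boldsymbol{n}\cdot\hat{\boldsymbol{n}}^\perp)}{\gamma(\boldsymbol{n})(\boldsymbol{n}\cdot\hat{\boldsymbol{n}}^\perp)^2},$$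 extended to $\hat{\boldsymbol{n}}=\boldsymbol{n}$ by its limit as $\hat{\boldsymbol{n}}\to\boldsymbol{n}$ in $\mathbb{S}^1$. The minimal stabilizing function is $k_0(\boldsymbol{n})=\max\{F(\boldsymbol{n},\hat{\boldsymbol{n}}):\hat{\boldsymbol{n}}\in\mathbb{S}^1,\ \hat{\boldsymbol{n}}\cdot\boldsymbol{n}\ge0\}$. *)

theory Defs
  imports "HOL-Analysis.Analysis"
begin

abbreviation unit_circle :: "(real^2) set" where
  "unit_circle \<equiv> sphere 0 1"

text \<open>Clockwise rotation by a right angle.\<close>

definition perp :: "real^2 \<Rightarrow> real^2" where
  "perp p = vector [p $ 2, - p $ 1]"

text \<open>A surface energy is a function \<open>\<gamma>\<close> of which only the values on the unit circle matter:
  all notions below look at \<open>\<gamma>\<close> on the circle or at its one-homogeneous extension.\<close>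

definition hom_ext :: "(real^2 \<Rightarrow> real) \<Rightarrow> real^2 \<Rightarrow> real" where
  "hom_ext \<gamma> p = (if p = 0 then 0 else norm p * \<gamma> (p /\<^sub>R norm p))"

definition xi :: "(real^2 \<Rightarrow> real) \<Rightarrow> real^2 \<Rightarrow> real^2" where
  "xi \<gamma> n = (THE D. GDERIV (hom_ext \<gamma>) n :> D)"

text \<open>The quotient is meaningful for \<open>m \<noteq> n\<close> and \<open>m \<noteq> - n\<close> only, where \<open>n\<close> and \<open>m\<close> are unit vectors.\<close>

definition F_quot :: "(real^2 \<Rightarrow> real) \<Rightarrow> real^2 \<Rightarrow> real^2 \<Rightarrow> real" where
  "F_quot \<gamma> n m =
     ((\<gamma> m)\<^sup>2 - (\<gamma> n)\<^sup>2 + 2 * \<gamma> n * (xi \<gamma> n \<bullet> perp m) * (n \<bullet> perp m))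
       / (\<gamma> n * (n \<bullet> perp m)\<^sup>2)"

definition F :: "(real^2 \<Rightarrow> real) \<Rightarrow> real^2 \<Rightarrow> real^2 \<Rightarrow> real" where
  "F \<gamma> n m = (if m = n then Lim (at n within unit_circle) (F_quot \<gamma> n) else F_quot \<gamma> n m)"

text \<open>A genuine maximum rather than a supremum: \<open>Greatest\<close> is specified only if the set has a
  largest element. The point \<open>- n\<close>, at which \<open>F\<close> has no meaning, is not in the half circle.\<close>

definition k0 :: "(real^2 \<Rightarrow> real) \<Rightarrow> real^2 \<Rightarrow> real" where
  "k0 \<gamma> n = (GREATEST k. k \<in> F \<gamma> n ` {m \<in> unit_circle. m \<bullet> n \<ge> 0})"

definition normal_at :: "real \<Rightarrow> real^2" where
  "normal_at \<theta> = vector [- sin \<theta>, cos \<theta>]"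

end

theory Submission imports Defs begin

text \<open>Along the circle put \<open>g \<theta> = \<gamma> (normal_at \<theta>)\<close> and let \<open>\<delta>\<close> be the angle from \<open>n = normal_at \<theta>\<close>
  to \<open>m\<close>. Since \<open>xi \<gamma> n = g \<theta> n + g' \<theta> \<tau>\<close> with \<open>\<tau>\<close> the unit tangent, \<open>F\<close> becomes
  \<open>(g (\<theta> + \<delta>)\<^sup>2 - g \<theta>\<^sup>2 + 2 g \<theta> (g \<theta> sin \<delta> - g' \<theta> cos \<delta>) sin \<delta>) / (g \<theta> sin\<^sup>2 \<delta>)\<close>.
  For both energies \<open>sin\<^sup>2 \<delta>\<close> cancels, which leaves a continuous function of \<open>\<delta>\<close>:
  \<open>4 - 2 g \<theta> + 4 \<beta>\<^sup>2 sin\<^sup>2 (2 \<theta> + \<delta>) / g \<theta>\<close> for the twofold energy, maximal where the sine is \<open>1\<close> or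
  \<open>-1\<close>, and \<open>2 g \<theta> + (16 \<beta>\<^sup>2 cos\<^sup>2 \<delta> sin\<^sup>2 (4 \<theta> + 2 \<delta>) - 16 \<beta> g \<theta> cos \<delta> cos (4 \<theta> + \<delta>)) / g \<theta>\<close>
  for the fourfold one. The bound on the latter is affine in \<open>\<beta>\<close>, so only \<open>\<beta> = 0\<close> and \<open>\<beta> = 1\<close>
  need to be checked.\<close>

section \<open>Parametrization of the circle by the angle\<close>

lemma normal_at_nth [simp]:
  "normal_at t $ 1 = - sin t" "normal_at t $ 2 = cos t"
  by (simp_all add: normal_at_def)

lemma inner_normal_at: "normal_at s \<bullet> normal_at t = cos (s - t)"
  by (simp add: inner_vec_def sum_2 cos_diff)

lemma inner_perp_normal_at: "normal_at s \<bullet> perp (normal_at t) = sin (t - s)"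
  by (simp add: inner_vec_def sum_2 perp_def sin_diff)

lemma norm_normal_at [simp]: "norm (normal_at t) = 1"
  by (simp add: norm_eq_1 inner_normal_at)

lemma normal_at_nonzero [simp]: "normal_at t \<noteq> 0"
  using norm_normal_at[of t] by (metis norm_zero zero_neq_one)

lemma normal_at_add:
  "normal_at (\<theta> + \<delta>) = cos \<delta> *\<^sub>R normal_at \<theta> + sin \<delta> *\<^sub>R normal_at (\<theta> + pi / 2)"
  by (simp add: vec_eq_iff forall_2 sin_add cos_add algebra_simps)

lemma normal_at_frame:
  "p = (p \<bullet> normal_at \<theta>) *\<^sub>R normal_at \<theta>
     + (p \<bullet> normal_at (\<theta> + pi / 2)) *\<^sub>R normal_at (\<theta> + pi / 2)"
proof -
  \<comment> \<open>The Pythagorean identity in right-nested form, so that it rewrites the products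
    produced by \<open>algebra_simps\<close>.\<close>
  have sc: "sin \<theta> * (sin \<theta> * x) = x - cos \<theta> * (cos \<theta> * x)" for x
  proof -
    have "(sin \<theta>)\<^sup>2 * x + (cos \<theta>)\<^sup>2 * x = x"
      by (simp flip: distrib_right)
    then show ?thesis by (simp add: power2_eq_square mult.assoc)
  qed
  show ?thesis
    by (simp add: vec_eq_iff forall_2 inner_vec_def sum_2 sin_add cos_add algebra_simps sc)
qed

lemma unit_circle_normal_at:
  assumes "n \<in> unit_circle"
  obtains t where "t \<in> {-pi..pi}" "n = normal_at t"
proof -
  have "(n $ 2)\<^sup>2 + (- n $ 1)\<^sup>2 = 1"
    using assms by (simp add: norm_eq_1 inner_vec_def sum_2 power2_eq_square)
  then obtain t where t: "-pi < t" "t \<le> pi" "n $ 2 = cos t" "- n $ 1 = sin t"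
    using sincos_principal_value sincos_total_2pi by (metis (no_types, opaque_lifting))
  then have "n = normal_at t"
    by (simp add: vec_eq_iff forall_2)
  with t show thesis by (intro that[of t]) auto
qed

text \<open>The formula is given on one period only, whereas the shifts \<theta> + \<delta> and
  derivatives at the endpoints need it for all real angles. It extends because the frequency
  \<open>k\<close> is an integer: two angles of the same point differ by a multiple of 2 pi.\<close>

lemma periodic_on_circle:
  assumes "\<forall>\<theta>\<in>{-pi..pi}. \<gamma> (normal_at \<theta>) = 1 + \<beta> * cos (of_nat k * \<theta>)"
  shows "\<gamma> (normal_at t) = 1 + \<beta> * cos (of_nat k * t)"
proof -
  obtain s where s: "s \<in> {-pi..pi}" "normal_at t = normal_at s"
    using unit_circle_normal_at[of "normal_at t"] by auto
  then have "sin t = sin s \<and> cos t = cos s"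
    by (metis normal_at_nth(1) normal_at_nth(2) neg_equal_iff_equal)
  then obtain i where "t = s + 2 * of_int i * pi"
    using sin_cos_eq_iff[of t s] by (auto simp: mult_ac)
  then have "of_nat k * t = of_nat k * s + 2 * pi * of_int (int k * i)"
    by (simp add: algebra_simps)
  then have "cos (of_nat k * t) = cos (of_nat k * s)"
    by (simp only: cos_add sin_int_2pin cos_int_2pin)
  with s assms show ?thesis by simp
qed

section \<open>Local polar coordinates and the gradient of the homogeneous extension\<close>

definition angle_from :: "real \<Rightarrow> real^2 \<Rightarrow> real" where
  "angle_from \<theta> p = arctan ((p \<bullet> normal_at (\<theta> + pi / 2)) / (p \<bullet> normal_at \<theta>))"

text \<open>The quotient in \<open>angle_from\<close> is the tangent of the signed angle from
  \<open>normal_at \<theta>\<close> to \<open>p\<close>. In the open half plane around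
  \<open>normal_at \<theta>\<close> this angle lies between -pi/2 and pi/2, where
  \<open>arctan\<close> recovers it without a choice of branch.\<close>

lemma polar_angle_from:
  assumes "p \<bullet> normal_at \<theta> > 0"
  shows "p = norm p *\<^sub>R normal_at (\<theta> + angle_from \<theta> p)"
proof -
  define a b where "a = p \<bullet> normal_at \<theta>" and "b = p \<bullet> normal_at (\<theta> + pi / 2)"
  have a: "a > 0" using assms by (simp add: a_def)
  have p: "p = a *\<^sub>R normal_at \<theta> + b *\<^sub>R normal_at (\<theta> + pi / 2)"
    using normal_at_frame[of p \<theta>] by (simp add: a_def b_def)
  have "p \<bullet> p = a * a + b * b"
    by (subst (1 2) p) (simp add: inner_add_left inner_add_right inner_normal_at)
  also have "\<dots> = a\<^sup>2 * (1 + (b / a)\<^sup>2)"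
    using a by (simp add: field_simps power2_eq_square)
  finally have "norm p = a * sqrt (1 + (b / a)\<^sup>2)"
    using a by (simp add: norm_eq_sqrt_inner real_sqrt_mult)
  \<comment> \<open>This root is the denominator in both the cosine and the sine of an arctangent;
    it cancels against \<open>norm p\<close>.\<close>
  moreover have "sqrt (1 + (b / a)\<^sup>2) \<noteq> 0"
    by (smt (verit) real_sqrt_gt_0_iff zero_le_power2)
  ultimately have "norm p * cos (angle_from \<theta> p) = a" "norm p * sin (angle_from \<theta> p) = b"
    using a by (simp_all add: angle_from_def cos_arctan sin_arctan flip: a_def b_def)
  then have "norm p *\<^sub>R normal_at (\<theta> + angle_from \<theta> p)
      = a *\<^sub>R normal_at \<theta> + b *\<^sub>R normal_at (\<theta> + pi / 2)"
    by (simp only: normal_at_add[of \<theta> "angle_from \<theta> p"] scaleR_add_right scaleR_scaleR)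
  then show ?thesis
    by (rule trans[OF p sym])
qed

lemma angle_from_self [simp]: "angle_from \<theta> (normal_at \<theta>) = 0"
  by (simp add: angle_from_def inner_normal_at)

lemma angle_from_has_derivative:
  "(angle_from \<theta> has_derivative (\<lambda>h. h \<bullet> normal_at (\<theta> + pi / 2))) (at (normal_at \<theta>))"
proof -
  have "((\<lambda>p. (p \<bullet> normal_at (\<theta> + pi / 2)) / (p \<bullet> normal_at \<theta>)) has_derivative
      (\<lambda>h. h \<bullet> normal_at (\<theta> + pi / 2))) (at (normal_at \<theta>))"
    by (rule derivative_eq_intros refl | simp add: inner_normal_at)+
  then show ?thesis
    unfolding angle_from_def
    by (auto intro!: derivative_eq_intros simp: inner_normal_at)
qed

lemma open_half_plane: "open {p. p \<bullet> normal_at \<theta> > 0}"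
  by (intro open_Collect_less continuous_intros)

text \<open>Near \<open>normal_at \<theta>\<close> the extension is radius times \<open>g\<close> of
  the polar angle. The product rule at radius 1 gives \<open>g \<theta>\<close> in the radial
  direction and \<open>g'\<close> in the tangential one.\<close>

lemma xi_normal_at:
  assumes \<gamma>: "\<And>t. \<gamma> (normal_at t) = g t" and g: "(g has_real_derivative g') (at \<theta>)"
  shows "xi \<gamma> (normal_at \<theta>) = g \<theta> *\<^sub>R normal_at \<theta> + g' *\<^sub>R normal_at (\<theta> + pi / 2)" (is "_ = ?D")
proof -
  have nrm: "(norm has_derivative (\<lambda>h. h \<bullet> normal_at \<theta>)) (at (normal_at \<theta>))"
    using has_derivative_norm[OF normal_at_nonzero, of \<theta>] by (simp add: sgn_div_norm inner_commute)
  have "((\<lambda>p. g (\<theta> + angle_from \<theta> p)) has_derivative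
      (\<lambda>h. g' * (h \<bullet> normal_at (\<theta> + pi / 2)))) (at (normal_at \<theta>))"
    using has_derivative_compose[OF has_derivative_add[OF has_derivative_const angle_from_has_derivative],
        of g "(*) g'" \<theta> \<theta>] g
    by (simp add: has_field_derivative_def)
  from has_derivative_mult[OF nrm this]
  have "((\<lambda>p. norm p * g (\<theta> + angle_from \<theta> p)) has_derivative (\<lambda>h. h \<bullet> ?D)) (at (normal_at \<theta>))"
    by (simp add: inner_add_right algebra_simps)
  moreover have "norm p * g (\<theta> + angle_from \<theta> p) = hom_ext \<gamma> p"
    if "p \<in> {p. p \<bullet> normal_at \<theta> > 0}" for p
  proof -
    have "p \<noteq> 0" using that by auto
    then have "p /\<^sub>R norm p = normal_at (\<theta> + angle_from \<theta> p)"
      using polar_angle_from[of p \<theta>] that by (subst polar_angle_from) auto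
    with \<open>p \<noteq> 0\<close> show ?thesis by (simp add: hom_ext_def \<gamma>)
  qed
  ultimately have D: "GDERIV (hom_ext \<gamma>) (normal_at \<theta>) :> ?D"
    unfolding gderiv_def
    using has_derivative_transform_within_open[OF _ open_half_plane[of \<theta>]]
    by (fastforce simp: inner_normal_at)
  \<comment> \<open>\<open>xi\<close> is a definite description, so the gradient must also be
    unique; this is uniqueness of the Frechet derivative.\<close>
  moreover have "E = ?D" if "GDERIV (hom_ext \<gamma>) (normal_at \<theta>) :> E" for E
  proof -
    have "(\<lambda>h. h \<bullet> E) = (\<lambda>h. h \<bullet> ?D)"
      using that D unfolding gderiv_def by (rule has_derivative_unique)
    then show ?thesis by (metis vector_eq_ldot)
  qed
  ultimately show ?thesis
    unfolding xi_def by (rule the_equality)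
qed

section \<open>The quotient as a function of the angle, its limit and its maximum\<close>

lemma F_quot_normal_at:
  assumes "\<And>t. \<gamma> (normal_at t) = g t" "(g has_real_derivative g') (at \<theta>)"
  shows "F_quot \<gamma> (normal_at \<theta>) (normal_at (\<theta> + \<delta>)) =
    ((g (\<theta> + \<delta>))\<^sup>2 - (g \<theta>)\<^sup>2 + 2 * g \<theta> * (g \<theta> * sin \<delta> - g' * cos \<delta>) * sin \<delta>)
      / (g \<theta> * (sin \<delta>)\<^sup>2)"
proof -
  \<comment> \<open>The tangent \<open>normal_at (\<theta> + pi / 2)\<close> paired with
    \<open>perp m\<close> gives this sine, hence the term with -g' cos \<delta>.\<close>
  have "sin (\<delta> - pi / 2) = - cos \<delta>"
    by (simp add: sin_diff)
  then show ?thesis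
    by (simp add: F_quot_def xi_normal_at[of \<gamma> g, OF assms] assms(1) inner_add_left
        inner_perp_normal_at)
qed

text \<open>\<open>H\<close> stands for the quotient after cancelling the squared sine. Close to
  \<open>normal_at \<theta>\<close> on the circle, the quotient is \<open>H\<close> composed with
  the continuous function \<open>angle_from \<theta>\<close>.\<close>

lemma Lim_F_quot:
  assumes H: "\<And>\<delta>. sin \<delta> \<noteq> 0 \<Longrightarrow> F_quot \<gamma> (normal_at \<theta>) (normal_at (\<theta> + \<delta>)) = H \<delta>"
    and cont: "isCont H 0"
  shows "Lim (at (normal_at \<theta>) within unit_circle) (F_quot \<gamma> (normal_at \<theta>)) = H 0"
proof (rule tendsto_Lim)
  let ?n = "normal_at \<theta>"
  \<comment> \<open>\<open>Lim\<close> is determined only along a nontrivial filter. A connected set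
    with more than one point has no isolated point.\<close>
  have "?n islimpt unit_circle"
  proof (rule connected_imp_perfect)
    show "connected unit_circle" by (rule connected_sphere) simp
    show "\<not> unit_circle = {x}" for x :: "real^2"
    proof
      assume "unit_circle = {x}"
      moreover have "normal_at 0 \<in> unit_circle" "normal_at pi \<in> unit_circle" by simp_all
      ultimately have "normal_at 0 = normal_at pi" by (metis singletonD)
      then have "normal_at 0 $ 2 = normal_at pi $ 2" by simp
      then show False by simp
    qed
  qed simp
  then show "\<not> trivial_limit (at ?n within unit_circle)"
    by (simp add: trivial_limit_within)
  have "isCont (angle_from \<theta>) ?n"
    using angle_from_has_derivative has_derivative_continuous by blast
  then have "isCont (\<lambda>m. H (angle_from \<theta> m)) ?n"
    by (rule isCont_o2) (simp add: cont)
  then have "continuous (at ?n within unit_circle) (\<lambda>m. H (angle_from \<theta> m))"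
    by (rule continuous_at_imp_continuous_at_within)
  then have "((\<lambda>m. H (angle_from \<theta> m)) \<longlongrightarrow> H 0) (at ?n within unit_circle)"
    by (simp add: continuous_within)
  moreover have "\<forall>\<^sub>F m in at ?n within unit_circle. H (angle_from \<theta> m) = F_quot \<gamma> ?n m"
  proof -
    have "\<forall>\<^sub>F m in at ?n within unit_circle. m \<in> {p. p \<bullet> ?n > 0}"
      by (rule topological_tendstoD[OF tendsto_ident_at open_half_plane]) (simp add: inner_normal_at)
    moreover have "\<forall>\<^sub>F m in at ?n within unit_circle. m \<in> unit_circle \<and> m \<noteq> ?n"
      by (auto simp: eventually_at_filter)
    ultimately show ?thesis
    proof eventually_elim
      case (elim m)
      then have m: "m = normal_at (\<theta> + angle_from \<theta> m)"
        using polar_angle_from[of m \<theta>] by simp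
      have "angle_from \<theta> m \<noteq> 0" using m elim by auto
      moreover have "\<bar>angle_from \<theta> m\<bar> < pi"
        using arctan_bounded[of "(m \<bullet> normal_at (\<theta> + pi / 2)) / (m \<bullet> ?n)"] pi_gt_zero
        by (simp add: angle_from_def abs_if)
      ultimately have "sin (angle_from \<theta> m) \<noteq> 0"
        using sin_eq_0_pi by (metis abs_less_iff minus_less_iff)
      from H[OF this] m show ?case by simp
    qed
  qed
  ultimately show "(F_quot \<gamma> ?n \<longlongrightarrow> H 0) (at ?n within unit_circle)"
    by (rule Lim_transform_eventually)
qed

text \<open>The closed half circle around \<open>normal_at \<theta>\<close> is the image of the
  angles from -pi/2 to pi/2. There the sine vanishes only at 0, where \<open>Lim_F_quot\<close>
  supplies the value, so \<open>F\<close> agrees with \<open>H\<close> throughout. A maximizer of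
  \<open>H\<close> then gives the largest element that \<open>Greatest\<close> needs.\<close>

lemma k0_eq_max:
  assumes H: "\<And>\<delta>. sin \<delta> \<noteq> 0 \<Longrightarrow> F_quot \<gamma> (normal_at \<theta>) (normal_at (\<theta> + \<delta>)) = H \<delta>"
    and cont: "isCont H 0"
    and \<delta>0: "\<delta>0 \<in> {-pi/2..pi/2}" and max: "\<And>\<delta>. \<delta> \<in> {-pi/2..pi/2} \<Longrightarrow> H \<delta> \<le> H \<delta>0"
  shows "k0 \<gamma> (normal_at \<theta>) = H \<delta>0"
proof -
  have F: "F \<gamma> (normal_at \<theta>) (normal_at (\<theta> + \<delta>)) = H \<delta>" if d: "\<delta> \<in> {-pi/2..pi/2}" for \<delta>
  proof (cases "\<delta> = 0")
    case True
    then show ?thesis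
      using Lim_F_quot[of \<gamma> \<theta> H, OF H cont] by (simp add: F_def)
  next
    case False
    have "-pi < \<delta>" "\<delta> < pi"
      using d pi_gt_zero unfolding atLeastAtMost_iff by linarith+
    with False have "sin \<delta> \<noteq> 0" using sin_eq_0_pi by blast
    \<comment> \<open>Pairing \<open>normal_at \<theta>\<close> with \<open>perp\<close> of these
      points gives sin \<delta> and 0, which separates them.\<close>
    moreover from this have "normal_at (\<theta> + \<delta>) \<noteq> normal_at \<theta>"
      using inner_perp_normal_at[of \<theta> "\<theta> + \<delta>"] inner_perp_normal_at[of \<theta> \<theta>] by auto
    ultimately show ?thesis by (simp add: F_def H)
  qed
  show ?thesis
    unfolding k0_def
  proof (rule Greatest_equality)
    have "normal_at (\<theta> + \<delta>0) \<in> {m \<in> unit_circle. m \<bullet> normal_at \<theta> \<ge> 0}"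
      using \<delta>0 by (simp add: inner_normal_at cos_ge_zero)
    then show "H \<delta>0 \<in> F \<gamma> (normal_at \<theta>) ` {m \<in> unit_circle. m \<bullet> normal_at \<theta> \<ge> 0}"
      by (rule rev_image_eqI) (simp only: F[OF \<delta>0])
  next
    fix k assume "k \<in> F \<gamma> (normal_at \<theta>) ` {m \<in> unit_circle. m \<bullet> normal_at \<theta> \<ge> 0}"
    then obtain m where m: "m \<in> unit_circle" "m \<bullet> normal_at \<theta> \<ge> 0" "k = F \<gamma> (normal_at \<theta>) m"
      by auto
    \<comment> \<open>The angle is the arcsine of the tangential coordinate \<open>y\<close>. Its
      cosine is the nonnegative root of 1 - y^2, which is \<open>x\<close> precisely because
      \<open>m\<close> lies in the half circle.\<close>
    obtain \<delta> where d: "\<delta> \<in> {-pi/2..pi/2}" "m = normal_at (\<theta> + \<delta>)"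
    proof -
      define x y where "x = m \<bullet> normal_at \<theta>" and "y = m \<bullet> normal_at (\<theta> + pi / 2)"
      have mxy: "m = x *\<^sub>R normal_at \<theta> + y *\<^sub>R normal_at (\<theta> + pi / 2)"
        using normal_at_frame[of m \<theta>] by (simp add: x_def y_def)
      have "m \<bullet> m = x\<^sup>2 + y\<^sup>2"
        by (subst (1 2) mxy)
          (simp add: inner_add_left inner_add_right inner_normal_at power2_eq_square)
      then have xy: "x\<^sup>2 + y\<^sup>2 = 1" using m(1) by (simp add: dot_square_norm)
      then have "\<bar>y\<bar> \<le> 1"
        by (metis abs_square_le_1 le_add_same_cancel2 zero_le_power2)
      then have y: "-1 \<le> y" "y \<le> 1" by auto
      have "x\<^sup>2 = 1 - y\<^sup>2" using xy by simp
      moreover have "0 \<le> x" using m(2) by (simp only: x_def)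
      ultimately have sqrt: "sqrt (1 - y\<^sup>2) = x" by (rule real_sqrt_unique)
      have "normal_at (\<theta> + arcsin y) = x *\<^sub>R normal_at \<theta> + y *\<^sub>R normal_at (\<theta> + pi / 2)"
        using y by (simp only: normal_at_add[of \<theta> "arcsin y"] cos_arcsin sin_arcsin sqrt)
      then have "m = normal_at (\<theta> + arcsin y)" by (simp only: mxy[symmetric])
      moreover have "arcsin y \<in> {-pi/2..pi/2}"
        using arcsin_lbound[OF y] arcsin_ubound[OF y] unfolding atLeastAtMost_iff by linarith
      ultimately show thesis by (rule that[rotated])
    qed
    then show "k \<le> H \<delta>0" using F m(3) max by auto
  qed
qed

section \<open>The twofold energy\<close>

lemma twofold_quotient:
  fixes \<beta> s c S C g :: real
  assumes "S \<noteq> 0" "g \<noteq> 0" and g: "g = 1 + \<beta> * c"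
  shows "((g - 2 * \<beta> * S * (s * C + c * S))\<^sup>2 - g\<^sup>2 + 2 * g * (g * S - - 2 * \<beta> * s * C) * S) / (g * S\<^sup>2)
    = 4 - 2 * g + 4 * \<beta>\<^sup>2 * (s * C + c * S)\<^sup>2 / g"
proof -
  \<comment> \<open>Here \<open>S\<close>, \<open>C\<close> play sin \<delta>, cos \<delta> and
    \<open>s\<close>, \<open>c\<close> play sin 2\<theta>, cos 2\<theta>, so s C + c S is sin
    (2\<theta> + \<delta>). The terms in g s C S cancel, every remaining term has the factor S^2,
    and \<beta> c = g - 1 removes \<open>c\<close> outside the squared sine.\<close>
  have "(g - 2 * \<beta> * S * (s * C + c * S))\<^sup>2 - g\<^sup>2 + 2 * g * (g * S - - 2 * \<beta> * s * C) * S
      = ((4 - 2 * g) * g + 4 * \<beta>\<^sup>2 * (s * C + c * S)\<^sup>2) * S\<^sup>2"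
    unfolding g by algebra
  then have "((g - 2 * \<beta> * S * (s * C + c * S))\<^sup>2 - g\<^sup>2 + 2 * g * (g * S - - 2 * \<beta> * s * C) * S) / (g * S\<^sup>2)
      = ((4 - 2 * g) * g + 4 * \<beta>\<^sup>2 * (s * C + c * S)\<^sup>2) * S\<^sup>2 / (g * S\<^sup>2)"
    by (simp only:)
  also have "\<dots> = ((4 - 2 * g) * g + 4 * \<beta>\<^sup>2 * (s * C + c * S)\<^sup>2) / g"
    using \<open>S \<noteq> 0\<close> by (subst mult_divide_mult_cancel_right) simp_all
  also have "\<dots> = 4 - 2 * g + 4 * \<beta>\<^sup>2 * (s * C + c * S)\<^sup>2 / g"
    using \<open>g \<noteq> 0\<close> by (subst add_divide_distrib) simp
  finally show ?thesis .
qed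

lemma one_plus_mult_cos_pos:
  fixes \<beta> t :: real
  assumes "0 \<le> \<beta>" "\<beta> < 1"
  shows "0 < 1 + \<beta> * cos t"
proof -
  have "\<beta> * -1 \<le> \<beta> * cos t" using assms by (intro mult_left_mono) simp_all
  with assms show ?thesis by linarith
qed

lemma k0_twofold:
  assumes \<beta>: "0 \<le> \<beta>" "\<beta> < 1" and \<gamma>: "\<And>t. \<gamma> (normal_at t) = 1 + \<beta> * cos (2 * t)"
  shows "k0 \<gamma> (normal_at \<theta>) = 4 - 2 * \<gamma> (normal_at \<theta>) + 4 * \<beta>\<^sup>2 / \<gamma> (normal_at \<theta>)"
proof -
  define g where "g = 1 + \<beta> * cos (2 * \<theta>)"
  have g: "g > 0"
    unfolding g_def using \<beta> by (rule one_plus_mult_cos_pos)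
  define H where "H \<delta> = 4 - 2 * g + 4 * \<beta>\<^sup>2 * (sin (2 * \<theta> + \<delta>))\<^sup>2 / g" for \<delta>
  have quot: "F_quot \<gamma> (normal_at \<theta>) (normal_at (\<theta> + \<delta>)) = H \<delta>" if "sin \<delta> \<noteq> 0" for \<delta>
  proof -
    define S C s c where "S = sin \<delta>" "C = cos \<delta>" "s = sin (2 * \<theta>)" "c = cos (2 * \<theta>)"
    note defs = this
    have gc: "g = 1 + \<beta> * c" by (simp only: g_def defs)
    have "((\<lambda>t. 1 + \<beta> * cos (2 * t)) has_real_derivative - 2 * \<beta> * s) (at \<theta>)"
      unfolding defs by (auto intro!: derivative_eq_intros)
    note F = F_quot_normal_at[of \<gamma>, OF \<gamma> this, of \<delta>]
    have cos: "cos (2 * (\<theta> + \<delta>)) = c * (1 - 2 * S\<^sup>2) - s * (2 * S * C)"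
      by (simp only: defs distrib_left cos_add cos_double_sin[of \<delta>] sin_double[of \<delta>])
    \<comment> \<open>The difference cos (2\<theta> + 2\<delta>) - cos 2\<theta> is -2 sin \<delta>
      sin (2\<theta> + \<delta>), which exposes a factor sin \<delta>.\<close>
    have g\<delta>: "1 + \<beta> * cos (2 * (\<theta> + \<delta>)) = g - 2 * \<beta> * S * (s * C + c * S)"
      unfolding cos gc by algebra
    have "F_quot \<gamma> (normal_at \<theta>) (normal_at (\<theta> + \<delta>)) =
        ((g - 2 * \<beta> * S * (s * C + c * S))\<^sup>2 - g\<^sup>2 + 2 * g * (g * S - - 2 * \<beta> * s * C) * S) / (g * S\<^sup>2)"
      by (simp only: F g\<delta> g_def[symmetric] defs(1,2)[symmetric])
    also have "\<dots> = 4 - 2 * g + 4 * \<beta>\<^sup>2 * (s * C + c * S)\<^sup>2 / g"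
    proof (rule twofold_quotient[OF _ _ gc])
      show "S \<noteq> 0" unfolding defs by (fact that)
      show "g \<noteq> 0" using g by simp
    qed
    also have "\<dots> = H \<delta>"
      by (simp only: H_def defs sin_add)
    finally show ?thesis .
  qed
  have cont: "isCont H 0" unfolding H_def using g by (intro continuous_intros) auto
  obtain \<delta>0 where d0: "\<delta>0 \<in> {-pi/2..pi/2}" "(sin (2 * \<theta> + \<delta>0))\<^sup>2 = 1"
  proof -
    \<comment> \<open>The interval from j pi to (j + 1) pi contains 2\<theta>. Its midpoint is an
      extremum of the sine at distance at most pi/2 from 2\<theta>, so the shift \<open>d\<close> to
      it is admissible.\<close>
    define j where "j = \<lfloor>2 * \<theta> / pi\<rfloor>"
    have "of_int j \<le> 2 * \<theta> / pi" "2 * \<theta> / pi < of_int j + 1"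
      unfolding j_def by linarith+
    then have j: "of_int j * pi \<le> 2 * \<theta>" "2 * \<theta> < (of_int j + 1) * pi"
      using pi_gt_zero by (simp_all only: pos_le_divide_eq pos_divide_less_eq)
    define d where "d = of_int j * pi + pi / 2 - 2 * \<theta>"
    have "2 * \<theta> + d = of_int j * pi + pi / 2" by (simp add: d_def)
    moreover have "sin (of_int j * pi) = 0" using sin_zero_iff_int2 by blast
    ultimately have "cos (2 * \<theta> + d) = 0"
      by (simp only: cos_add) simp
    then have "(sin (2 * \<theta> + d))\<^sup>2 = 1"
      by (simp only: sin_squared_eq) simp
    moreover have "d \<in> {-pi/2..pi/2}"
      using j unfolding d_def distrib_right atLeastAtMost_iff by linarith
    ultimately show thesis by (rule that[rotated])
  qed
  have "H \<delta> \<le> H \<delta>0" for \<delta>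
    unfolding H_def d0(2) using g
    by (intro add_left_mono divide_right_mono mult_left_mono) (simp_all add: abs_square_le_1)
  then have "k0 \<gamma> (normal_at \<theta>) = H \<delta>0" by (intro k0_eq_max[OF quot cont d0(1)])
  then show ?thesis unfolding H_def d0(2) g_def \<gamma> by simp
qed

section \<open>The fourfold energy\<close>

lemma fourfold_bound:
  fixes a \<beta> \<delta> :: real
  assumes "0 \<le> \<beta>" "\<beta> \<le> 1"
  shows "\<beta> * (cos \<delta>)\<^sup>2 * (sin (a + 2 * \<delta>))\<^sup>2 - (1 + \<beta> * cos a) * cos \<delta> * cos (a + \<delta>) \<le> 1 + \<beta>"
proof -
  \<comment> \<open>The product-to-sum formula turns cos \<delta> cos (a + \<delta>) into (v + u)/2.
    Bounding cos^2 \<delta> by 1 in \<open>q\<close> then leaves an inequality in \<open>u\<close>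
    and \<open>v\<close> alone.\<close>
  define u v q where "u = cos (a + 2 * \<delta>)" "v = cos a" "q = (cos \<delta>)\<^sup>2 * (sin (a + 2 * \<delta>))\<^sup>2"
  note defs = this
  have "\<delta> - (a + \<delta>) = - a" "\<delta> + (a + \<delta>) = a + 2 * \<delta>" by simp_all
  then have prod: "cos \<delta> * cos (a + \<delta>) = (v + u) / 2"
    unfolding defs cos_times_cos by (simp only: cos_minus)
  have "q \<le> (sin (a + 2 * \<delta>))\<^sup>2"
    unfolding defs by (rule mult_left_le_one_le) (simp_all add: abs_square_le_1)
  also have "\<dots> = 1 - u\<^sup>2" by (simp only: defs sin_squared_eq)
  finally have sq: "q \<le> 1 - u\<^sup>2" .
  \<comment> \<open>The case \<beta> = 1, doubled: completing the square first in \<open>u\<close>,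
    then in \<open>v\<close>, leaves the positive constant 5/3.\<close>
  have "(u + v / 2 + 1 / 2)\<^sup>2 + u\<^sup>2 + 3 / 4 * (v + 1 / 3)\<^sup>2 + 5 / 3 \<ge> 0"
    by (intro add_nonneg_nonneg mult_nonneg_nonneg zero_le_power2) simp_all
  also have "(u + v / 2 + 1 / 2)\<^sup>2 + u\<^sup>2 + 3 / 4 * (v + 1 / 3)\<^sup>2 + 5 / 3
      = 2 * (1 + u\<^sup>2 + (1 + v) * ((v + u) / 2))"
    by (simp add: power2_eq_square field_simps)
  finally have "0 \<le> 1 + u\<^sup>2 + (1 + v) * ((v + u) / 2)"
    by (simp only: zero_le_mult_iff) simp
  with sq have one: "q - (1 + v) * ((v + u) / 2) \<le> 2"
    by (simp only: diff_le_eq)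
  have "-1 \<le> v" "-1 \<le> u" by (simp_all only: defs cos_ge_minus_one)
  then have zero: "- ((v + u) / 2) \<le> 1" by simp
  have "\<beta> * (cos \<delta>)\<^sup>2 * (sin (a + 2 * \<delta>))\<^sup>2 - (1 + \<beta> * cos a) * cos \<delta> * cos (a + \<delta>)
      = \<beta> * q - (1 + \<beta> * v) * ((v + u) / 2)"
    unfolding mult.assoc prod by (simp only: defs)
  \<comment> \<open>Affine interpolation between \<beta> = 0 and \<beta> = 1, with weights 1 -
    \<beta> and \<beta>.\<close>
  also have "\<dots> = (1 - \<beta>) * - ((v + u) / 2) + \<beta> * (q - (1 + v) * ((v + u) / 2))"
    by algebra
  also have "\<dots> \<le> (1 - \<beta>) * 1 + \<beta> * 2"
    using assms zero one by (intro add_mono mult_left_mono) simp_all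
  also have "\<dots> = 1 + \<beta>" by simp
  finally show ?thesis .
qed

lemma fourfold_quotient:
  fixes \<beta> s c S C g W :: real
  assumes "S \<noteq> 0" "g \<noteq> 0" and W: "W = s * (1 - 2 * S\<^sup>2) + c * (2 * S * C)"
  shows "((g - 4 * \<beta> * S * C * W)\<^sup>2 - g\<^sup>2 + 2 * g * (g * S - - 4 * \<beta> * s * C) * S) / (g * S\<^sup>2)
    = 2 * g + 16 * \<beta> * (\<beta> * C\<^sup>2 * W\<^sup>2 - g * C * (c * C - s * S)) / g"
proof -
  \<comment> \<open>This is sin 4\<theta> = sin (4\<theta> + 2\<delta>) - 2 sin \<delta> cos
    (4\<theta> + \<delta>). Substituted into the derivative term, it cancels the part that is only
    linear in \<open>S\<close>.\<close>
  have sW: "s = W - 2 * S * (c * C - s * S)"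
    unfolding W by algebra
  have "(g - 4 * \<beta> * S * C * W)\<^sup>2 - g\<^sup>2 + 2 * g * (g * S - - 4 * \<beta> * s * C) * S
      = (2 * g * g + 16 * \<beta> * (\<beta> * C\<^sup>2 * W\<^sup>2 - g * C * (c * C - s * S))) * S\<^sup>2"
    using sW by algebra
  then have "((g - 4 * \<beta> * S * C * W)\<^sup>2 - g\<^sup>2 + 2 * g * (g * S - - 4 * \<beta> * s * C) * S) / (g * S\<^sup>2)
      = (2 * g * g + 16 * \<beta> * (\<beta> * C\<^sup>2 * W\<^sup>2 - g * C * (c * C - s * S))) * S\<^sup>2 / (g * S\<^sup>2)"
    by (simp only:)
  also have "\<dots> = (2 * g * g + 16 * \<beta> * (\<beta> * C\<^sup>2 * W\<^sup>2 - g * C * (c * C - s * S))) / g"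
    using \<open>S \<noteq> 0\<close> by (subst mult_divide_mult_cancel_right) simp_all
  also have "\<dots> = 2 * g + 16 * \<beta> * (\<beta> * C\<^sup>2 * W\<^sup>2 - g * C * (c * C - s * S)) / g"
    using \<open>g \<noteq> 0\<close> by (subst add_divide_distrib) simp
  finally show ?thesis .
qed

lemma k0_fourfold:
  assumes \<beta>: "0 \<le> \<beta>" "\<beta> < 1" and \<gamma>: "\<And>t. \<gamma> (normal_at t) = 1 + \<beta> * cos (4 * t)"
  shows "k0 \<gamma> (normal_at \<theta>) \<le> 2 * \<gamma> (normal_at \<theta>) + (16 * \<beta> + 16 * \<beta>\<^sup>2) / \<gamma> (normal_at \<theta>)"
proof -
  define g where "g = 1 + \<beta> * cos (4 * \<theta>)"
  have g: "g > 0"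
    unfolding g_def using \<beta> by (rule one_plus_mult_cos_pos)
  define H where "H \<delta> = 2 * g + 16 * \<beta> * (\<beta> * (cos \<delta>)\<^sup>2 * (sin (4 * \<theta> + 2 * \<delta>))\<^sup>2
      - g * cos \<delta> * cos (4 * \<theta> + \<delta>)) / g" for \<delta>
  have quot: "F_quot \<gamma> (normal_at \<theta>) (normal_at (\<theta> + \<delta>)) = H \<delta>" if "sin \<delta> \<noteq> 0" for \<delta>
  proof -
    define S C s c W where "S = sin \<delta>" "C = cos \<delta>" "s = sin (4 * \<theta>)" "c = cos (4 * \<theta>)"
      "W = sin (4 * \<theta> + 2 * \<delta>)"
    note defs = this
    have gc: "g = 1 + \<beta> * c" by (simp only: g_def defs)
    have "((\<lambda>t. 1 + \<beta> * cos (4 * t)) has_real_derivative - 4 * \<beta> * s) (at \<theta>)"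
      unfolding defs by (auto intro!: derivative_eq_intros)
    note F = F_quot_normal_at[of \<gamma>, OF \<gamma> this, of \<delta>]
    have W: "W = s * (1 - 2 * S\<^sup>2) + c * (2 * S * C)"
      by (simp only: defs sin_add cos_double_sin[of \<delta>] sin_double[of \<delta>])
    have "4 * (\<theta> + \<delta>) = 4 * \<theta> + 2 * (2 * \<delta>)" by simp
    then have cos: "cos (4 * (\<theta> + \<delta>))
        = c * (1 - 2 * (2 * S * C)\<^sup>2) - s * (2 * (2 * S * C) * (1 - 2 * S\<^sup>2))"
      by (simp only: defs cos_add cos_double_sin[of "2 * \<delta>"] sin_double[of "2 * \<delta>"]
          cos_double_sin[of \<delta>] sin_double[of \<delta>])
    \<comment> \<open>The difference of cosines is -2 sin 2\<delta> sin (4\<theta> + 2\<delta>), and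
      sin 2\<delta> = 2 S C.\<close>
    have g\<delta>: "1 + \<beta> * cos (4 * (\<theta> + \<delta>)) = g - 4 * \<beta> * S * C * W"
      unfolding cos gc W by algebra
    have "F_quot \<gamma> (normal_at \<theta>) (normal_at (\<theta> + \<delta>)) =
        ((g - 4 * \<beta> * S * C * W)\<^sup>2 - g\<^sup>2 + 2 * g * (g * S - - 4 * \<beta> * s * C) * S) / (g * S\<^sup>2)"
      by (simp only: F g\<delta> g_def[symmetric] defs(1,2)[symmetric])
    also have "\<dots> = 2 * g + 16 * \<beta> * (\<beta> * C\<^sup>2 * W\<^sup>2 - g * C * (c * C - s * S)) / g"
    proof (rule fourfold_quotient[OF _ _ W])
      show "S \<noteq> 0" unfolding defs by (fact that)
      show "g \<noteq> 0" using g by simp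
    qed
    also have "\<dots> = H \<delta>"
      by (simp only: H_def defs cos_add[of "4 * \<theta>" \<delta>])
    finally show ?thesis .
  qed
  have cont: "continuous_on A H" for A
    unfolding H_def using g by (intro continuous_intros) auto
  have isCont: "isCont H 0"
    unfolding H_def using g by (intro continuous_intros) auto
  \<comment> \<open>The maximizer is not explicit here. Compactness provides one, so
    \<open>k0\<close> is a value of \<open>H\<close> and the pointwise bound applies to it.\<close>
  have "\<exists>x\<in>{-pi/2..pi/2}. \<forall>y\<in>{-pi/2..pi/2}. H y \<le> H x"
    by (rule continuous_attains_sup[OF _ _ cont]) simp_all
  then obtain \<delta>0 where d0: "\<delta>0 \<in> {-pi/2..pi/2}" "\<And>\<delta>. \<delta> \<in> {-pi/2..pi/2} \<Longrightarrow> H \<delta> \<le> H \<delta>0"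
    by blast
  have "k0 \<gamma> (normal_at \<theta>) = H \<delta>0" by (rule k0_eq_max[OF quot isCont d0])
  also have "H \<delta>0 \<le> 2 * g + 16 * \<beta> * (1 + \<beta>) / g"
    unfolding H_def using \<beta> g fourfold_bound[of \<beta> \<delta>0 "4 * \<theta>", folded g_def]
    by (intro add_left_mono divide_right_mono mult_left_mono) simp_all
  also have "16 * \<beta> * (1 + \<beta>) = 16 * \<beta> + 16 * \<beta>\<^sup>2" by algebra
  finally show ?thesis unfolding g_def \<gamma> .
qed

theorem lemma4p9:
  fixes \<beta> :: real and \<gamma> :: "real^2 \<Rightarrow> real"
  assumes "0 \<le> \<beta>" and "\<beta> < 1"
  shows "((\<forall>\<theta>\<in>{-pi..pi}. \<gamma> (normal_at \<theta>) = 1 + \<beta> * cos (2 * \<theta>)) \<longrightarrow>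
           (\<forall>n\<in>unit_circle. k0 \<gamma> n = 4 - 2 * \<gamma> n + 4 * \<beta>\<^sup>2 / \<gamma> n)) \<and>
         ((\<forall>\<theta>\<in>{-pi..pi}. \<gamma> (normal_at \<theta>) = 1 + \<beta> * cos (4 * \<theta>)) \<longrightarrow>
           (\<forall>n\<in>unit_circle. k0 \<gamma> n \<le> 2 * \<gamma> n + (16 * \<beta> + 16 * \<beta>\<^sup>2) / \<gamma> n))"
proof (intro conjI impI ballI)
  fix n :: "real^2"
  assume n: "n \<in> unit_circle"
  then obtain \<theta> where \<theta>: "n = normal_at \<theta>" by (rule unit_circle_normal_at)
  {
    assume "\<forall>\<theta>\<in>{-pi..pi}. \<gamma> (normal_at \<theta>) = 1 + \<beta> * cos (2 * \<theta>)"
    then show "k0 \<gamma> n = 4 - 2 * \<gamma> n + 4 * \<beta>\<^sup>2 / \<gamma> n"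
      unfolding \<theta> using assms periodic_on_circle[of \<gamma> \<beta> 2] by (intro k0_twofold) auto
  next
    assume "\<forall>\<theta>\<in>{-pi..pi}. \<gamma> (normal_at \<theta>) = 1 + \<beta> * cos (4 * \<theta>)"
    then show "k0 \<gamma> n \<le> 2 * \<gamma> n + (16 * \<beta> + 16 * \<beta>\<^sup>2) / \<gamma> n"
      unfolding \<theta> using assms periodic_on_circle[of \<gamma> \<beta> 4] by (intro k0_fourfold) auto
  }
qed

end
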